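(* Let $D=\{x_1,\dots,x_d\}$ be a dictionary of strings over $[1..\sigma]$ with lengths $n_1,\dots,n_d$, total length $n=\sum_i n_i$, and let $N=\sum_{i=1}^{d} n_i(n_i-1)/2$. The two-error approximate dictionary data structure built on $D$ (as described in the context) occupies $O(N\log\sigma)$ bits, and the peak space used during its construction is $O(N\log\sigma)$ bits. If bit-compaction is applied, the final data structure occupies at most $(N+2n)(\log\sigma+O(1))$ bits.
   Context: Model: word RAM with word length $w=\Omega(\log n)$; space measured in bits. Fixed constants: load factor $0<\alpha<1$, signature length $r=O(1)$, rank sampling parameter $\delta=O(1)$. Linear probing hash table with $t$ slots: an element with hash value $h$ is inserted at the first empty slot among $h\bmod t,(h+1)\bmod t,\dots$. A table storing $k$ items has $\lceil k/\alpha\rceil$ slots. The two-error structure consists of: (1) an exact dictionary: words grouped by length, each group in a linear probing hash table keyed by the word; (2) a level-1 substitution store: a linear probing table where, for each word $x_i$ and each position $j$, the character $x_i[j]$ with an $r$-bit signature derived from the hash of $x_i[1..j-1]\phi x_i[j+1..n_i]$ ($\phi$ a wildcard) is inserted starting at that hash position; (3) a level-2 substitution store: a linear probing table where, for each word $x_i$ and each pair of positions $j<j'$ in $[1..n_i]$, the character $x_i[j]$ with an $r$-bit signature is inserted under the key obtained from $x_i$ by replacing both positions $j$ and $j'$ with $\phi$. Bit-compaction of a table with $T$ slots of which $k$ are occupied replaces it by a $T$-bit vector marking non-empty slots, augmented with a rank structure storing cumulative counts every $\delta$ machine words ($T(1+O(1/\delta))$ bits total), and an array of the $k$ non-empty slots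 in order.
   Formalization: Words are assumed nonempty; the O(N log σ) bounds assume σ ≥ 2 and n ≤ cN for a fixed arbitrary c (they fail for one-letter words, where N=0, or σ=1); peak space with b working words also assumes bw ≤ K·N log σ (vacuous if b=0). *)

theory Defs
  imports Complex_Main
begin

section \<open>Dictionaries\<close>

definition is_dictionary :: "nat \<Rightarrow> nat list list \<Rightarrow> bool" where
  "is_dictionary \<sigma> xs \<longleftrightarrow> distinct xs \<and> (\<forall>x\<in>set xs. x \<noteq> [] \<and> set x \<subseteq> {1..\<sigma>})"

definition total_length :: "nat list list \<Rightarrow> nat" where
  "total_length xs = (\<Sum>i<length xs. length (xs ! i))"

text \<open>The division is exact: each summand is a product of two consecutive numbers.\<close>

definition num_pairs :: "nat list list \<Rightarrow> nat" where
  "num_pairs xs = (\<Sum>i<length xs. length (xs ! i) * (length (xs ! i) - 1) div 2)"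


section \<open>Linear probing tables and their bit-compaction\<close>

datatype table_id = Exact nat | Subst1 | Subst2

text \<open>\<^term>\<open>Cell c s\<close> is a character \<open>c\<close> together with a signature \<open>s\<close>.\<close>

datatype entry = Word "nat list" | Cell nat nat

type_synonym table = "entry option list"

definition slots :: "real \<Rightarrow> nat \<Rightarrow> nat" where
  "slots \<alpha> k = nat \<lceil>real k / \<alpha>\<rceil>"

text \<open>Only meaningful if the table has an empty slot, which is always the case
  below: a table for \<open>k > 0\<close> entries has more than \<open>k\<close> slots, as the load factor is
  less than 1.\<close>

definition lp_insert :: "nat \<Rightarrow> entry \<Rightarrow> table \<Rightarrow> table" where
  "lp_insert a e t =
     t[(a + (LEAST k. t ! ((a + k) mod length t) = None)) mod length t := Some e]"

record packed_table =
  marks :: "bool list"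
  counts :: "nat list"
  content :: "entry list"

text \<open>The \<open>p\<close>-th stored count (\<open>p \<ge> 1\<close>) is the number of non-empty slots among the first
  \<open>p \<cdot> \<delta>\<close> machine words of the bit vector, each of \<open>w\<close> bits.\<close>

definition compact_table :: "nat \<Rightarrow> nat \<Rightarrow> table \<Rightarrow> packed_table" where
  "compact_table \<delta> w t =
     \<lparr>marks = map (\<lambda>s. s \<noteq> None) t,
      counts = map (\<lambda>p. length (filter (\<lambda>s. s \<noteq> None) (take (p * (\<delta> * w)) t)))
                 [1..<Suc (length t div (\<delta> * w))],
      content = map the (filter (\<lambda>s. s \<noteq> None) t)\<rparr>"


section \<open>Space in bits\<close>

definition char_bits :: "nat \<Rightarrow> nat" where
  "char_bits \<sigma> = nat \<lceil>log 2 (real \<sigma>)\<rceil>"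

fun entry_bits :: "nat \<Rightarrow> nat \<Rightarrow> table_id \<Rightarrow> nat" where
  "entry_bits \<sigma> r (Exact l) = l * char_bits \<sigma>"
| "entry_bits \<sigma> r Subst1 = char_bits \<sigma> + r"
| "entry_bits \<sigma> r Subst2 = char_bits \<sigma> + r"

text \<open>All slots have the same width, whether occupied or not; the additional bit tells
  empty slots from occupied ones.\<close>

definition table_bits :: "nat \<Rightarrow> nat \<Rightarrow> table_id \<Rightarrow> table \<Rightarrow> nat" where
  "table_bits \<sigma> r i t = length t * (1 + entry_bits \<sigma> r i)"

text \<open>Number of \<open>w\<close>-bit machine words needed for a number in \<open>{0..m}\<close>.\<close>

definition words_for :: "nat \<Rightarrow> nat \<Rightarrow> nat" where
  "words_for w m = nat \<lceil>log 2 (real m + 1) / real w\<rceil>"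

definition packed_bits :: "nat \<Rightarrow> nat \<Rightarrow> nat \<Rightarrow> table_id \<Rightarrow> packed_table \<Rightarrow> nat" where
  "packed_bits \<sigma> r w i p =
     length (marks p)
     + length (counts p) * (words_for w (length (marks p)) * w)
     + length (content p) * entry_bits \<sigma> r i"

record memory =
  tables :: "table_id \<rightharpoonup> table"
  packed :: "table_id \<rightharpoonup> packed_table"

definition memory_bits :: "nat \<Rightarrow> nat \<Rightarrow> nat \<Rightarrow> memory \<Rightarrow> nat" where
  "memory_bits \<sigma> r w M =
     (\<Sum>i\<in>dom (tables M). table_bits \<sigma> r i (the (tables M i)))
     + (\<Sum>i\<in>dom (packed M). packed_bits \<sigma> r w i (the (packed M i)))"


section \<open>Construction\<close>

datatype instr = Alloc table_id nat | Insert table_id nat entry | Pack table_id | Free table_id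

fun exec :: "nat \<Rightarrow> nat \<Rightarrow> memory \<Rightarrow> instr \<Rightarrow> memory" where
  "exec \<delta> w M (Alloc i T) = M\<lparr>tables := (tables M)(i \<mapsto> replicate T None)\<rparr>"
| "exec \<delta> w M (Insert i a e) = M\<lparr>tables := (tables M)(i \<mapsto> lp_insert a e (the (tables M i)))\<rparr>"
| "exec \<delta> w M (Pack i) = M\<lparr>packed := (packed M)(i \<mapsto> compact_table \<delta> w (the (tables M i)))\<rparr>"
| "exec \<delta> w M (Free i) = M\<lparr>tables := (tables M)(i := None)\<rparr>"

definition run :: "nat \<Rightarrow> nat \<Rightarrow> instr list \<Rightarrow> memory" where
  "run \<delta> w P = foldl (exec \<delta> w) \<lparr>tables = Map.empty, packed = Map.empty\<rparr> P"

text \<open>The items of a table are pairs of a hash value and an entry.\<close>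

definition fill :: "real \<Rightarrow> table_id \<Rightarrow> (nat \<times> entry) list \<Rightarrow> instr list" where
  "fill \<alpha> i items = Alloc i (slots \<alpha> (length items)) # map (\<lambda>(a, e). Insert i a e) items"

text \<open>Hash keys are strings over the alphabet extended by the wildcard, which is
  \<^const>\<open>None\<close>. The signature is a function \<open>sg\<close> of the hash value.\<close>

definition exact_items :: "(nat option list \<Rightarrow> nat) \<Rightarrow> nat list list \<Rightarrow> nat \<Rightarrow> (nat \<times> entry) list" where
  "exact_items h xs l = [(h (map Some x), Word x). x \<leftarrow> xs, length x = l]"

definition subst1_items ::
  "(nat option list \<Rightarrow> nat) \<Rightarrow> (nat \<Rightarrow> nat) \<Rightarrow> nat list list \<Rightarrow> (nat \<times> entry) list" where
  "subst1_items h sg xs =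
     [let a = h ((map Some x)[j := None]) in (a, Cell (x ! j) (sg a)).
       x \<leftarrow> xs, j \<leftarrow> [0..<length x]]"

definition subst2_items ::
  "(nat option list \<Rightarrow> nat) \<Rightarrow> (nat \<Rightarrow> nat) \<Rightarrow> nat list list \<Rightarrow> (nat \<times> entry) list" where
  "subst2_items h sg xs =
     [let a = h ((map Some x)[j := None, j' := None]) in (a, Cell (x ! j) (sg a)).
       x \<leftarrow> xs, j \<leftarrow> [0..<length x], j' \<leftarrow> [Suc j..<length x]]"

definition build ::
  "real \<Rightarrow> (nat option list \<Rightarrow> nat) \<Rightarrow> (nat \<Rightarrow> nat) \<Rightarrow> nat list list \<Rightarrow> instr list" where
  "build \<alpha> h sg xs =
     concat (map (\<lambda>l. fill \<alpha> (Exact l) (exact_items h xs l)) (remdups (map length xs)))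
     @ fill \<alpha> Subst1 (subst1_items h sg xs)
     @ fill \<alpha> Subst2 (subst2_items h sg xs)"

definition bit_compaction :: "nat list list \<Rightarrow> instr list" where
  "bit_compaction xs =
     concat (map (\<lambda>i. [Pack i, Free i]) (map Exact (remdups (map length xs)) @ [Subst1, Subst2]))"

text \<open>Besides the tables, the peak space accounts for the input strings and for \<open>b\<close> machine
  words of working storage.\<close>

definition peak_bits :: "nat \<Rightarrow> nat \<Rightarrow> nat \<Rightarrow> nat \<Rightarrow> nat \<Rightarrow> nat list list \<Rightarrow> instr list \<Rightarrow> nat" where
  "peak_bits \<sigma> r \<delta> w b xs P =
     b * w + total_length xs * char_bits \<sigma>
     + Max ((\<lambda>k. memory_bits \<sigma> r w (run \<delta> w (take k P))) ` {..length P})"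

end

theory Submission
  imports Defs
begin

text \<open>Every memory configuration reached by the construction consists of tables, or packed tables,
  whose number of slots is at most a constant multiple of the number of their items. The rank counts
  of a packed table with \<open>T\<close> slots take \<open>O(T)\<close> bits because \<open>T\<close> is polynomial in \<open>n\<close>, so that a
  count fits into \<open>O(1)\<close> machine words. There are at most \<open>n\<close>, exactly \<open>n\<close> and exactly \<open>N\<close> items
  in the three parts, and the exact dictionary takes \<open>l\<close> characters for a word of length \<open>l\<close>; this
  yields the factor \<open>N + 2 n\<close>.\<close>

section \<open>Tables\<close>

definition occupied :: "table \<Rightarrow> nat" where
  "occupied t = length (filter (\<lambda>s. s \<noteq> None) t)"

lemma length_filter_list_update_le:
  "length (filter P (xs[i := v])) \<le> Suc (length (filter P xs))"
  by (induction xs arbitrary: i) (auto split: nat.split intro: le_SucI)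

lemma length_lp_insert [simp]: "length (lp_insert a e t) = length t"
  by (simp add: lp_insert_def)

text \<open>An insertion rewrites a single slot, so the bound holds wherever the probe ends.\<close>

lemma occupied_lp_insert: "occupied (lp_insert a e t) \<le> Suc (occupied t)"
  unfolding occupied_def lp_insert_def by (rule length_filter_list_update_le)

text \<open>The length is fixed at allocation, but occupancy is only bounded from above. The
  predicate thus covers a partly filled table as well as the finished one.\<close>

definition table_for :: "real \<Rightarrow> nat \<Rightarrow> table \<Rightarrow> bool" where
  "table_for \<alpha> k t \<longleftrightarrow> length t = slots \<alpha> k \<and> occupied t \<le> k"

text \<open>The ceiling costs at most one slot, which one item pays for when \<open>k\<close> is
  positive; for \<open>k = 0\<close> there are no slots. This keeps the bound purely multiplicative
  in \<open>k\<close>.\<close>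

lemma slots_le:
  assumes "0 < \<alpha>"
  shows "real (slots \<alpha> k) \<le> (1 / \<alpha> + 1) * real k"
proof (cases k)
  case 0
  then show ?thesis by (simp add: slots_def)
next
  case (Suc m)
  have "real (slots \<alpha> k) \<le> real k / \<alpha> + 1"
    unfolding slots_def using assms by (simp add: of_nat_nat)
  also have "\<dots> \<le> (1 / \<alpha> + 1) * real k"
    unfolding distrib_right using Suc by simp
  finally show ?thesis .
qed

section \<open>Memory configurations\<close>

text \<open>The invariant of the whole construction. Containment of both domains in \<open>S\<close>
  lets every sum over allocated tables be bounded by one over \<open>S\<close>; a packed table is
  described through the table it came from.\<close>

definition memory_for ::
  "real \<Rightarrow> nat \<Rightarrow> nat \<Rightarrow> table_id set \<Rightarrow> (table_id \<Rightarrow> nat) \<Rightarrow> memory \<Rightarrow> bool" where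
  "memory_for \<alpha> \<delta> w S k M \<longleftrightarrow>
     dom (tables M) \<subseteq> S \<and> dom (packed M) \<subseteq> S \<and>
     (\<forall>i t. tables M i = Some t \<longrightarrow> table_for \<alpha> (k i) t) \<and>
     (\<forall>i p. packed M i = Some p \<longrightarrow> (\<exists>t. table_for \<alpha> (k i) t \<and> p = compact_table \<delta> w t))"

lemma memory_for_empty:
  "memory_for \<alpha> \<delta> w S k \<lparr>tables = Map.empty, packed = Map.empty\<rparr>"
  by (simp add: memory_for_def)

lemma memory_for_tables_upd:
  assumes "memory_for \<alpha> \<delta> w S k M" "i \<in> S" "table_for \<alpha> (k i) t"
  shows "memory_for \<alpha> \<delta> w S k (M\<lparr>tables := (tables M)(i \<mapsto> t)\<rparr>)"
  using assms by (auto simp: memory_for_def)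

text \<open>Packing reads \<open>the (tables M i)\<close>, which is a proper table only if
  \<open>i\<close> is allocated.\<close>

lemma memory_for_Pack:
  assumes "memory_for \<alpha> \<delta> w S k M" "i \<in> dom (tables M)"
  shows "memory_for \<alpha> \<delta> w S k (exec \<delta> w M (Pack i))"
  using assms by (fastforce simp: memory_for_def)

lemma memory_for_Free:
  assumes "memory_for \<alpha> \<delta> w S k M"
  shows "memory_for \<alpha> \<delta> w S k (exec \<delta> w M (Free i))"
  using assms by (auto simp: memory_for_def)

section \<open>Preservation of the invariant along instruction sequences\<close>

text \<open>The peak is a maximum over all prefixes, so the invariant must hold after each of them,
  from the empty prefix on; \<open>take\<close> saturates, so \<open>k\<close> may range over all
  numbers.\<close>

definition throughout :: "(memory \<Rightarrow> bool) \<Rightarrow> nat \<Rightarrow> nat \<Rightarrow> memory \<Rightarrow> instr list \<Rightarrow> bool" where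
  "throughout Q \<delta> w M P \<longleftrightarrow> (\<forall>k. Q (foldl (exec \<delta> w) M (take k P)))"

lemma throughout_Nil [simp]: "throughout Q \<delta> w M [] \<longleftrightarrow> Q M"
  by (simp add: throughout_def)

lemma throughout_Cons:
  "throughout Q \<delta> w M (s # P) \<longleftrightarrow> Q M \<and> throughout Q \<delta> w (exec \<delta> w M s) P"
proof (intro iffI conjI)
  assume *: "throughout Q \<delta> w M (s # P)"
  show "Q M" using *[unfolded throughout_def, rule_format, of 0] by simp
  show "throughout Q \<delta> w (exec \<delta> w M s) P"
    unfolding throughout_def
    using *[unfolded throughout_def, rule_format, of "Suc _"] by simp
next
  assume *: "Q M \<and> throughout Q \<delta> w (exec \<delta> w M s) P"
  show "throughout Q \<delta> w M (s # P)"
    unfolding throughout_def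
  proof
    fix k show "Q (foldl (exec \<delta> w) M (take k (s # P)))"
      using * by (cases k) (auto simp: throughout_def)
  qed
qed

lemma throughout_append:
  assumes "throughout Q \<delta> w M P" "throughout Q \<delta> w (foldl (exec \<delta> w) M P) P'"
  shows "throughout Q \<delta> w M (P @ P')"
  using assms by (induction P arbitrary: M) (auto simp: throughout_Cons)

lemma throughout_last:
  assumes "throughout Q \<delta> w M P"
  shows "Q (foldl (exec \<delta> w) M P)"
  using assms unfolding throughout_def by (metis take_all order_refl)

text \<open>Budget argument: each insertion uses up one item and fills at most one slot, so
  \<open>occupied t + length items\<close> never grows. The domain is tracked as well because
  packing later requires allocated tables.\<close>

lemma throughout_inserts:
  assumes "memory_for \<alpha> \<delta> w S k M" "i \<in> S" "tables M i = Some t"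
    "length t = slots \<alpha> (k i)" "occupied t + length items \<le> k i"
  shows "throughout (memory_for \<alpha> \<delta> w S k) \<delta> w M (map (\<lambda>(a, e). Insert i a e) items)
    \<and> dom (tables (foldl (exec \<delta> w) M (map (\<lambda>(a, e). Insert i a e) items))) = dom (tables M)"
  using assms
proof (induction items arbitrary: M t)
  case Nil
  then show ?case by simp
next
  case (Cons ae items)
  obtain a e where ae: "ae = (a, e)" by (cases ae)
  have occ: "occupied (lp_insert a e t) + length items \<le> k i"
    using occupied_lp_insert[of a e t] Cons.prems by simp
  define M' where "M' = exec \<delta> w M (Insert i a e)"
  have "memory_for \<alpha> \<delta> w S k M'"
    using Cons.prems occ unfolding M'_def
    by (auto intro!: memory_for_tables_upd simp: table_for_def)
  moreover have "tables M' i = Some (lp_insert a e t)" "dom (tables M') = dom (tables M)"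
    using Cons.prems by (auto simp: M'_def)
  ultimately show ?case
    using Cons.IH[of M', OF _ \<open>i \<in> S\<close> _ _ occ] Cons.prems
    by (simp add: ae throughout_Cons del: exec.simps flip: M'_def)
qed

lemma throughout_fill:
  assumes "memory_for \<alpha> \<delta> w S k M" "i \<in> S" "k i = length items"
  shows "throughout (memory_for \<alpha> \<delta> w S k) \<delta> w M (fill \<alpha> i items)
    \<and> dom (tables (foldl (exec \<delta> w) M (fill \<alpha> i items))) = insert i (dom (tables M))"
proof -
  let ?t = "replicate (slots \<alpha> (length items)) (None :: entry option)"
  let ?M = "exec \<delta> w M (Alloc i (slots \<alpha> (length items)))"
  have occ: "occupied ?t = 0" by (simp add: occupied_def)
  have "memory_for \<alpha> \<delta> w S k ?M"
    using assms occ by (auto intro!: memory_for_tables_upd simp: table_for_def)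
  from throughout_inserts[OF this \<open>i \<in> S\<close>, of ?t items] assms occ
  show ?thesis by (auto simp: fill_def throughout_Cons)
qed

lemma throughout_fills:
  assumes "memory_for \<alpha> \<delta> w S k M" "set js \<subseteq> S" "\<And>i. k i = length (items i)"
  shows "throughout (memory_for \<alpha> \<delta> w S k) \<delta> w M (concat (map (\<lambda>i. fill \<alpha> i (items i)) js))
    \<and> dom (tables (foldl (exec \<delta> w) M (concat (map (\<lambda>i. fill \<alpha> i (items i)) js))))
        = set js \<union> dom (tables M)"
  using assms
proof (induction js arbitrary: M)
  case Nil
  then show ?case by simp
next
  case (Cons i js)
  have f: "throughout (memory_for \<alpha> \<delta> w S k) \<delta> w M (fill \<alpha> i (items i))"
    "dom (tables (foldl (exec \<delta> w) M (fill \<alpha> i (items i)))) = insert i (dom (tables M))"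
    using throughout_fill[of \<alpha> \<delta> w S k M i "items i"] Cons.prems by auto
  have g: "throughout (memory_for \<alpha> \<delta> w S k) \<delta> w (foldl (exec \<delta> w) M (fill \<alpha> i (items i)))
      (concat (map (\<lambda>i. fill \<alpha> i (items i)) js))"
    "dom (tables (foldl (exec \<delta> w) (foldl (exec \<delta> w) M (fill \<alpha> i (items i)))
        (concat (map (\<lambda>i. fill \<alpha> i (items i)) js)))) = set js \<union> insert i (dom (tables M))"
    using Cons.IH[OF throughout_last[OF f(1)] _ Cons.prems(3)] Cons.prems(2) f(2) by simp_all
  show ?case
    using throughout_append[OF f(1) g(1)] g(2) by simp
qed

text \<open>Each table is freed right after it is packed; \<open>distinct js\<close> ensures that
  the ids still to be packed remain allocated.\<close>

lemma throughout_packs: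
  assumes "memory_for \<alpha> \<delta> w S k M" "distinct js" "set js \<subseteq> dom (tables M)"
  shows "throughout (memory_for \<alpha> \<delta> w S k) \<delta> w M (concat (map (\<lambda>i. [Pack i, Free i]) js))
    \<and> dom (tables (foldl (exec \<delta> w) M (concat (map (\<lambda>i. [Pack i, Free i]) js))))
        = dom (tables M) - set js"
  using assms
proof (induction js arbitrary: M)
  case Nil
  then show ?case by simp
next
  case (Cons i js)
  let ?M1 = "exec \<delta> w M (Pack i)" and ?M2 = "exec \<delta> w (exec \<delta> w M (Pack i)) (Free i)"
  have 1: "memory_for \<alpha> \<delta> w S k ?M1"
    using Cons.prems by (intro memory_for_Pack) auto
  have 2: "memory_for \<alpha> \<delta> w S k ?M2"
    using 1 by (rule memory_for_Free)
  have d: "dom (tables ?M2) = dom (tables M) - {i}" by auto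
  have "set js \<subseteq> dom (tables ?M2)" using Cons.prems d by auto
  with Cons.IH[OF 2] Cons.prems(2)
  have "throughout (memory_for \<alpha> \<delta> w S k) \<delta> w ?M2 (concat (map (\<lambda>i. [Pack i, Free i]) js))"
    "dom (tables (foldl (exec \<delta> w) ?M2 (concat (map (\<lambda>i. [Pack i, Free i]) js))))
      = dom (tables M) - {i} - set js"
    unfolding d by simp_all
  with Cons.prems(1) 1 show ?case
    by (simp add: throughout_Cons Diff_insert2 [symmetric] del: exec.simps)
qed

section \<open>Tables of the two-error structure\<close>

text \<open>The order is that of \<open>build\<close> and \<open>bit_compaction\<close>, so that
  both become a \<open>concat\<close> over this one list.\<close>

definition table_ids :: "nat list list \<Rightarrow> table_id list" where
  "table_ids xs = map Exact (remdups (map length xs)) @ [Subst1, Subst2]"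

fun table_items ::
  "(nat option list \<Rightarrow> nat) \<Rightarrow> (nat \<Rightarrow> nat) \<Rightarrow> nat list list \<Rightarrow> table_id \<Rightarrow> (nat \<times> entry) list" where
  "table_items h sg xs (Exact l) = exact_items h xs l"
| "table_items h sg xs Subst1 = subst1_items h sg xs"
| "table_items h sg xs Subst2 = subst2_items h sg xs"

fun num_items :: "nat list list \<Rightarrow> table_id \<Rightarrow> nat" where
  "num_items xs (Exact l) = length (filter (\<lambda>x. length x = l) xs)"
| "num_items xs Subst1 = total_length xs"
| "num_items xs Subst2 = num_pairs xs"

lemma distinct_table_ids: "distinct (table_ids xs)"
  by (auto simp: table_ids_def distinct_map inj_on_def)

lemma total_length_eq: "total_length xs = sum_list (map length xs)"
  by (simp add: total_length_def sum_list_sum_nth atLeast0LessThan)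

lemma num_pairs_eq: "num_pairs xs = (\<Sum>x\<leftarrow>xs. length x * (length x - 1) div 2)"
  by (simp add: num_pairs_def sum_list_sum_nth atLeast0LessThan)

text \<open>Position \<open>j\<close> has \<open>m - Suc j\<close> partners to its right. Reversing
  the order of summation gives the Gauss sum.\<close>

lemma sum_list_pairs: "(\<Sum>j\<leftarrow>[0..<m]. m - Suc j) = m * (m - 1) div 2"
proof -
  have "(\<Sum>j\<leftarrow>[0..<m]. m - Suc j) = (\<Sum>j<m. m - Suc j)"
    by (simp add: sum_list_distinct_conv_sum_set atLeast0LessThan)
  also have "\<dots> = (\<Sum>j<m. j)"
    by (rule sum.nat_diff_reindex)
  also have "\<dots> = m * (m - 1) div 2"
    using gauss_sum_nat[of "m - 1"]
    by (cases m) (simp_all add: lessThan_Suc_atMost atMost_atLeast0 mult.commute)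
  finally show ?thesis .
qed

lemma length_table_items: "length (table_items h sg xs i) = num_items xs i"
proof (cases i)
  case (Exact l)
  then show ?thesis by (induction xs) (auto simp: exact_items_def)
next
  case Subst1
  then show ?thesis
    by (simp add: subst1_items_def length_concat total_length_eq comp_def)
next
  case Subst2
  then show ?thesis
    by (simp add: subst2_items_def length_concat num_pairs_eq comp_def sum_list_pairs)
qed

lemma build_eq: "build \<alpha> h sg xs = concat (map (\<lambda>i. fill \<alpha> i (table_items h sg xs i)) (table_ids xs))"
  by (simp add: build_def table_ids_def comp_def)

lemma bit_compaction_eq: "bit_compaction xs = concat (map (\<lambda>i. [Pack i, Free i]) (table_ids xs))"
  by (simp add: bit_compaction_def table_ids_def)

text \<open>Filling allocates exactly the listed ids and packing frees exactly these. Hence the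
  invariant survives both phases and only packed tables are left at the end.\<close>

lemma throughout_build:
  fixes \<alpha> \<delta> w xs
  defines "M0 \<equiv> \<lparr>tables = Map.empty, packed = Map.empty\<rparr>"
    and "Q \<equiv> memory_for \<alpha> \<delta> w (set (table_ids xs)) (num_items xs)"
  shows "throughout Q \<delta> w M0 (build \<alpha> h sg xs)"
    and "throughout Q \<delta> w M0 (build \<alpha> h sg xs @ bit_compaction xs)"
    and "tables (run \<delta> w (build \<alpha> h sg xs @ bit_compaction xs)) = Map.empty"
proof -
  have 1: "throughout Q \<delta> w M0 (build \<alpha> h sg xs)"
    "dom (tables (foldl (exec \<delta> w) M0 (build \<alpha> h sg xs))) = set (table_ids xs)"
    using throughout_fills[where M = M0 and js = "table_ids xs" and S = "set (table_ids xs)"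
        and k = "num_items xs" and items = "table_items h sg xs" and \<alpha> = \<alpha> and \<delta> = \<delta> and w = w]
    by (simp_all add: Q_def M0_def build_eq memory_for_empty length_table_items)
  show "throughout Q \<delta> w M0 (build \<alpha> h sg xs)" by (fact 1)
  have 2: "throughout Q \<delta> w (foldl (exec \<delta> w) M0 (build \<alpha> h sg xs)) (bit_compaction xs)"
    "dom (tables (foldl (exec \<delta> w) (foldl (exec \<delta> w) M0 (build \<alpha> h sg xs)) (bit_compaction xs))) = {}"
    using throughout_packs[OF throughout_last[OF 1(1), unfolded Q_def] distinct_table_ids] 1(2)
    by (simp_all add: Q_def bit_compaction_eq)
  show "throughout Q \<delta> w M0 (build \<alpha> h sg xs @ bit_compaction xs)"
    using 1(1) 2(1) by (rule throughout_append)
  show "tables (run \<delta> w (build \<alpha> h sg xs @ bit_compaction xs)) = Map.empty"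
    using 2(2) by (simp add: run_def M0_def)
qed

section \<open>Numbers of items and entry widths\<close>

text \<open>Double counting: summing over length classes is summing over words. It serves with
  \<open>g\<close> constantly 1 to count the words, and with
  \<open>g l = l * char_bits \<sigma>\<close> to add up their widths.\<close>

lemma sum_filter_length:
  assumes "finite S" "length ` set xs \<subseteq> S"
  shows "(\<Sum>l\<in>S. length (filter (\<lambda>x. length x = l) xs) * g l) = (\<Sum>x\<leftarrow>xs. g (length x))"
  using assms(2)
proof (induction xs)
  case Nil
  then show ?case by simp
next
  case (Cons x xs)
  \<comment> \<open>The new word raises the count of its own length class only.\<close>
  have "(\<Sum>l\<in>S. length (filter (\<lambda>y. length y = l) (x # xs)) * g l)
      = (\<Sum>l\<in>S. (if l = length x then g l else 0) + length (filter (\<lambda>x. length x = l) xs) * g l)"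
    by (rule sum.cong) auto
  also have "\<dots> = g (length x) + (\<Sum>x\<leftarrow>xs. g (length x))"
    using Cons assms(1) by (simp add: sum.distrib sum.delta)
  finally show ?case by simp
qed

lemma length_le_total_length:
  assumes "is_dictionary \<sigma> xs"
  shows "length xs \<le> total_length xs"
proof -
  have "(\<Sum>x\<leftarrow>xs. 1) \<le> (\<Sum>x\<leftarrow>xs. length x)"
    using assms by (intro sum_list_mono) (auto simp: is_dictionary_def Suc_le_eq)
  then show ?thesis by (simp add: total_length_eq sum_list_triv)
qed

lemma sum_table_ids:
  "(\<Sum>i\<in>set (table_ids xs). f i) = (\<Sum>l\<in>length ` set xs. f (Exact l)) + f Subst1 + f Subst2"
proof -
  have "(\<Sum>i\<in>set (table_ids xs). f i) = (\<Sum>i\<in>Exact ` length ` set xs. f i) + (\<Sum>i\<in>{Subst1, Subst2}. f i)"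
    by (simp only: table_ids_def set_append set_map set_remdups list.set)
      (rule sum.union_disjoint, auto)
  also have "(\<Sum>i\<in>Exact ` length ` set xs. f i) = (\<Sum>l\<in>length ` set xs. f (Exact l))"
    by (simp add: sum.reindex inj_on_def)
  finally show ?thesis by (simp add: add.assoc)
qed

text \<open>Words are nonempty, so the exact dictionary has at most n items; level 1 has n and level
  2 has N.\<close>

lemma sum_num_items:
  assumes "is_dictionary \<sigma> xs"
  shows "(\<Sum>i\<in>set (table_ids xs). num_items xs i) \<le> num_pairs xs + 2 * total_length xs"
  using sum_filter_length[of "length ` set xs" xs "\<lambda>_. 1"] length_le_total_length[OF assms]
  by (simp add: sum_table_ids sum_list_triv)

text \<open>The exact dictionary stores n characters in total, level 1 stores n and level 2 stores
  N. Granting the exact part \<open>r\<close> bits per character as well gives the common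
  factor.\<close>

lemma sum_num_items_entry_bits:
  "(\<Sum>i\<in>set (table_ids xs). num_items xs i * entry_bits \<sigma> r i)
    \<le> (num_pairs xs + 2 * total_length xs) * (char_bits \<sigma> + r)"
  using sum_filter_length[of "length ` set xs" xs "\<lambda>l. l * char_bits \<sigma>"]
  by (simp add: sum_table_ids total_length_eq sum_list_mult_const sum_list_const_mult algebra_simps)

lemma num_pairs_le: "num_pairs xs \<le> (total_length xs)\<^sup>2"
proof -
  have "length x * (length x - 1) div 2 \<le> length x * total_length xs" if "x \<in> set xs" for x
  proof -
    have "length x * (length x - 1) div 2 \<le> length x * (length x - 1)" by simp
    also have "\<dots> \<le> length x * total_length xs"
      using member_le_sum_list[of "length x" "map length xs"] that
      by (intro mult_left_mono) (auto simp: total_length_eq)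
    finally show ?thesis .
  qed
  then have "num_pairs xs \<le> (\<Sum>x\<leftarrow>xs. length x * total_length xs)"
    unfolding num_pairs_eq by (intro sum_list_mono)
  also have "\<dots> = (total_length xs)\<^sup>2"
    by (simp add: sum_list_mult_const total_length_eq power2_eq_square)
  finally show ?thesis .
qed

text \<open>A uniform polynomial bound on table sizes: its logarithm is 2 log n, which is
  O(w).\<close>

lemma num_items_le:
  assumes "is_dictionary \<sigma> xs"
  shows "num_items xs i \<le> (total_length xs)\<^sup>2"
proof -
  have "total_length xs \<le> (total_length xs)\<^sup>2" by (simp add: power2_eq_square)
  moreover have "length (filter P xs) \<le> total_length xs" for P
    using length_filter_le length_le_total_length[OF assms] by (rule order_trans)
  ultimately show ?thesis
    using num_pairs_le[of xs] by (cases i) (auto intro: order_trans)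
qed

lemma char_bits_le: "1 \<le> \<sigma> \<Longrightarrow> real (char_bits \<sigma>) \<le> log 2 (real \<sigma>) + 1"
  by (simp add: char_bits_def of_nat_nat)

section \<open>Space bounds\<close>

lemma words_for_le:
  assumes "0 < w"
  shows "real (words_for w m * w) \<le> log 2 (real m + 1) + real w"
proof -
  have "real (words_for w m) \<le> log 2 (real m + 1) / real w + 1"
    by (simp add: words_for_def of_nat_nat)
  then show ?thesis
    using assms by (simp add: field_simps)
qed

lemma table_bits_le:
  assumes "0 < \<alpha>" "table_for \<alpha> k t"
  shows "real (table_bits \<sigma> r i t) \<le> (1 / \<alpha> + 1) * (real k * (1 + real (entry_bits \<sigma> r i)))"
proof -
  have "real (table_bits \<sigma> r i t) = real (slots \<alpha> k) * (1 + real (entry_bits \<sigma> r i))"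
    using assms by (simp add: table_bits_def table_for_def distrib_left)
  also have "\<dots> \<le> ((1 / \<alpha> + 1) * real k) * (1 + real (entry_bits \<sigma> r i))"
    using assms by (intro mult_right_mono slots_le) auto
  finally show ?thesis by (simp only: mult.assoc)
qed

text \<open>Bounds the machine words taken by one rank count: the first two terms bound the
  logarithm of the slot number divided by w, and the last one pays for rounding up to whole
  words.\<close>

definition rank_const :: "real \<Rightarrow> real \<Rightarrow> real" where
  "rank_const \<alpha> \<kappa> = log 2 (1 / \<alpha> + 2) + 2 / \<kappa> + 1"

lemma rank_const_nonneg: "0 < \<alpha> \<Longrightarrow> 0 < \<kappa> \<Longrightarrow> 0 \<le> rank_const \<alpha> \<kappa>"
  unfolding rank_const_def by (intro add_nonneg_nonneg zero_le_log_cancel_iff[THEN iffD2]) (auto intro: add_pos_pos)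

lemma log_slots_le:
  assumes "0 < \<alpha>" "0 < \<kappa>" "0 < w" "\<kappa> * log 2 (real n) \<le> real w" "k \<le> n\<^sup>2"
  shows "log 2 (real (slots \<alpha> k) + 1) + real w \<le> rank_const \<alpha> \<kappa> * real w"
proof -
  have L: "0 \<le> log 2 (1 / \<alpha> + 2)" using assms by (intro zero_le_log_cancel_iff[THEN iffD2]) (auto intro: add_pos_pos)
  \<comment> \<open>Since w is at least 1, a constant number of bits is at most that constant times
    w.\<close>
  then have L': "log 2 (1 / \<alpha> + 2) \<le> log 2 (1 / \<alpha> + 2) * real w"
    using assms by (simp add: mult_le_cancel_left1)
  have "log 2 (real (slots \<alpha> k) + 1) \<le> log 2 (1 / \<alpha> + 2) * real w + 2 / \<kappa> * real w"
  proof (cases "n = 0")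
    case True
    then have "slots \<alpha> k = 0" using assms by (simp add: slots_def)
    then show ?thesis using assms L by simp
  next
    case False
    \<comment> \<open>For positive n the summand 1 is at most n^2, which turns the factor
      \<open>1 / \<alpha> + 1\<close> into \<open>1 / \<alpha> + 2\<close>.\<close>
    have "real (slots \<alpha> k) + 1 \<le> (1 / \<alpha> + 1) * (real n)\<^sup>2 + (real n)\<^sup>2"
    proof (rule add_mono)
      show "real (slots \<alpha> k) \<le> (1 / \<alpha> + 1) * (real n)\<^sup>2"
        using slots_le[OF assms(1), of k] assms
        by (elim order_trans) (intro mult_left_mono, auto simp flip: of_nat_power)
      show "1 \<le> (real n)\<^sup>2" using False by (simp flip: of_nat_power)
    qed
    also have "\<dots> = (1 / \<alpha> + 2) * (real n)\<^sup>2" by (simp add: algebra_simps)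
    finally have "log 2 (real (slots \<alpha> k) + 1) \<le> log 2 ((1 / \<alpha> + 2) * (real n)\<^sup>2)"
      by (intro log_mono) auto
    also have "\<dots> = log 2 (1 / \<alpha> + 2) + 2 * log 2 (real n)"
    proof -
      have "0 < 1 / \<alpha> + 2" using assms by (simp add: add_pos_pos)
      then show ?thesis using False by (simp add: log_mult log_nat_power)
    qed
    also have "2 * log 2 (real n) \<le> 2 / \<kappa> * real w"
      using assms by (simp add: field_simps)
    finally show ?thesis using L' by simp
  qed
  then show ?thesis by (simp add: rank_const_def algebra_simps)
qed

text \<open>There are at most T / w counts of O(w) bits each, so the word length cancels and the
  rank structure costs O(T) = O(k) bits. The entry width keeps the coefficient 1.\<close>

lemma packed_bits_le:
  assumes "0 < \<alpha>" "0 < \<kappa>" "1 \<le> \<delta>" "0 < w" "\<kappa> * log 2 (real n) \<le> real w" "k \<le> n\<^sup>2"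
    and "table_for \<alpha> k t"
  shows "real (packed_bits \<sigma> r w i (compact_table \<delta> w t))
    \<le> (1 / \<alpha> + 1) * (1 + rank_const \<alpha> \<kappa>) * real k + real (k * entry_bits \<sigma> r i)"
proof -
  let ?E = "rank_const \<alpha> \<kappa>" and ?T = "slots \<alpha> k"
  have T: "length t = ?T" "occupied t \<le> k" using assms(7) by (auto simp: table_for_def)
  have E: "0 \<le> ?E" using assms by (intro rank_const_nonneg)
  have "real (?T div (\<delta> * w)) * real (words_for w ?T * w) \<le> real ?T / real w * (?E * real w)"
  proof (rule mult_mono)
    have "real (?T div (\<delta> * w)) \<le> real (?T div w)"
      using assms by (intro of_nat_mono div_le_mono2) auto
    also have "\<dots> \<le> real ?T / real w" by (rule of_nat_div_le_of_nat)
    finally show "real (?T div (\<delta> * w)) \<le> real ?T / real w" .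
    show "real (words_for w ?T * w) \<le> ?E * real w"
      using words_for_le[OF assms(4), of ?T] log_slots_le[OF assms(1,2,4,5,6)] by linarith
  qed auto
  also have "\<dots> = real ?T * ?E" using assms by simp
  finally have counts: "real (?T div (\<delta> * w)) * real (words_for w ?T * w) \<le> real ?T * ?E" .
  have "real (packed_bits \<sigma> r w i (compact_table \<delta> w t))
      = real ?T + real (?T div (\<delta> * w)) * real (words_for w ?T * w)
        + real (occupied t) * real (entry_bits \<sigma> r i)"
    using T by (simp add: packed_bits_def compact_table_def occupied_def)
  \<comment> \<open>Entries are charged per item and not per slot; this is what makes the leading
    constant 1.\<close>
  also have "\<dots> \<le> real ?T + real ?T * ?E + real k * real (entry_bits \<sigma> r i)"
    using T counts by (intro add_mono mult_right_mono) auto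
  also have "real ?T + real ?T * ?E = (1 + ?E) * real ?T" by (simp add: algebra_simps)
  also have "\<dots> \<le> (1 + ?E) * ((1 / \<alpha> + 1) * real k)"
    using E slots_le[OF assms(1)] by (intro mult_left_mono) auto
  finally show ?thesis by (simp add: ac_simps)
qed

text \<open>Overhead per item beyond log \<sigma>: one bit for the ceiling in
  \<open>char_bits\<close>, the signature, and the share of the bit vector with its rank
  counts.\<close>

definition packed_const :: "real \<Rightarrow> real \<Rightarrow> nat \<Rightarrow> real" where
  "packed_const \<alpha> \<kappa> r = 1 + real r + (1 / \<alpha> + 1) * (1 + rank_const \<alpha> \<kappa>)"

lemma sum_dom_le:
  fixes f g :: "'a \<Rightarrow> real"
  assumes "finite S" "dom m \<subseteq> S" "\<And>i y. m i = Some y \<Longrightarrow> F i y \<le> g i" "\<And>i. 0 \<le> g i"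
  shows "(\<Sum>i\<in>dom m. F i (the (m i))) \<le> sum g S"
proof -
  have "(\<Sum>i\<in>dom m. F i (the (m i))) \<le> sum g (dom m)"
    using assms(3) by (intro sum_mono) auto
  also have "\<dots> \<le> sum g S" using assms by (intro sum_mono2) auto
  finally show ?thesis .
qed

section \<open>Sums over all tables of one dictionary\<close>

context
  fixes \<alpha> \<kappa> :: real and r \<delta> \<sigma> w :: nat and xs :: "nat list list" and G :: real
  assumes \<alpha>: "0 < \<alpha>" and \<kappa>: "0 < \<kappa>" and \<delta>: "1 \<le> \<delta>" and w: "0 < w"
    and dict: "is_dictionary \<sigma> xs" and word: "\<kappa> * log 2 (real (total_length xs)) \<le> real w"
  defines "G \<equiv> real (num_pairs xs) + 2 * real (total_length xs)"
begin

lemma char_bits_mult_le: "G * real (char_bits \<sigma>) \<le> G * (log 2 (real \<sigma>) + 1)"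
proof (cases "\<sigma> = 0")
  case True
  \<comment> \<open>Over the empty alphabet there are no nonempty words, so the factor
    \<open>G\<close> vanishes.\<close>
  then have "xs = []"
    using dict by (cases xs) (auto simp: is_dictionary_def)
  then show ?thesis by (simp add: G_def num_pairs_def total_length_def)
next
  case False
  then show ?thesis by (intro mult_left_mono char_bits_le) (auto simp: G_def)
qed

lemma real_sum_num_items: "(\<Sum>i\<in>set (table_ids xs). real (num_items xs i)) \<le> G"
  using of_nat_mono[OF sum_num_items[OF dict], where 'a = real] by (simp add: G_def)

lemma real_sum_num_items_entry_bits:
  "(\<Sum>i\<in>set (table_ids xs). real (num_items xs i * entry_bits \<sigma> r i))
    \<le> G * (log 2 (real \<sigma>) + 1 + real r)"
proof -
  have "(\<Sum>i\<in>set (table_ids xs). real (num_items xs i * entry_bits \<sigma> r i))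
      \<le> G * (real (char_bits \<sigma>) + real r)"
    using of_nat_mono[OF sum_num_items_entry_bits[of xs \<sigma> r], where 'a = real] by (simp add: G_def)
  then show ?thesis using char_bits_mult_le by (simp add: algebra_simps)
qed

lemma packed_sum_le:
  assumes "memory_for \<alpha> \<delta> w (set (table_ids xs)) (num_items xs) M"
  shows "(\<Sum>i\<in>dom (packed M). real (packed_bits \<sigma> r w i (the (packed M i))))
    \<le> G * (log 2 (real \<sigma>) + packed_const \<alpha> \<kappa> r)"
proof -
  let ?B = "(1 / \<alpha> + 1) * (1 + rank_const \<alpha> \<kappa>)" and ?k = "num_items xs"
  have B: "0 \<le> ?B" using \<alpha> \<kappa> rank_const_nonneg[of \<alpha> \<kappa>] by simp
  have "(\<Sum>i\<in>dom (packed M). real (packed_bits \<sigma> r w i (the (packed M i))))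
      \<le> (\<Sum>i\<in>set (table_ids xs). ?B * real (?k i) + real (?k i * entry_bits \<sigma> r i))"
  proof (rule sum_dom_le[where F = "\<lambda>i p. real (packed_bits \<sigma> r w i p)"])
    show "real (packed_bits \<sigma> r w i p) \<le> ?B * real (?k i) + real (?k i * entry_bits \<sigma> r i)"
      if "packed M i = Some p" for i p
      using that assms packed_bits_le[OF \<alpha> \<kappa> \<delta> w word num_items_le[OF dict]]
      unfolding memory_for_def by blast
  qed (use assms B in \<open>auto simp: memory_for_def\<close>)
  also have "\<dots> = ?B * (\<Sum>i\<in>set (table_ids xs). real (?k i))
      + (\<Sum>i\<in>set (table_ids xs). real (?k i * entry_bits \<sigma> r i))"
    by (simp only: sum.distrib sum_distrib_left)
  also have "\<dots> \<le> ?B * G + G * (log 2 (real \<sigma>) + 1 + real r)"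
    using B real_sum_num_items real_sum_num_items_entry_bits by (intro add_mono mult_left_mono)
  also have "\<dots> = G * (log 2 (real \<sigma>) + packed_const \<alpha> \<kappa> r)"
    by (simp add: packed_const_def algebra_simps)
  finally show ?thesis .
qed

text \<open>Here empty slots have full width too, so the load factor multiplies log \<sigma>. The 2
  combines the occupancy bit of a slot and the rounding of \<open>char_bits\<close>.\<close>

lemma tables_sum_le:
  assumes "memory_for \<alpha> \<delta> w (set (table_ids xs)) (num_items xs) M"
  shows "(\<Sum>i\<in>dom (tables M). real (table_bits \<sigma> r i (the (tables M i))))
    \<le> (1 / \<alpha> + 1) * (G * (log 2 (real \<sigma>) + 2 + real r))"
proof -
  let ?A = "1 / \<alpha> + 1" and ?k = "num_items xs"
  have A: "0 \<le> ?A" using \<alpha> by simp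
  have "(\<Sum>i\<in>dom (tables M). real (table_bits \<sigma> r i (the (tables M i))))
      \<le> (\<Sum>i\<in>set (table_ids xs). ?A * (real (?k i) * (1 + real (entry_bits \<sigma> r i))))"
  proof (rule sum_dom_le[where F = "\<lambda>i t. real (table_bits \<sigma> r i t)"])
    show "real (table_bits \<sigma> r i t) \<le> ?A * (real (?k i) * (1 + real (entry_bits \<sigma> r i)))"
      if "tables M i = Some t" for i t
      using that assms table_bits_le[OF \<alpha>] unfolding memory_for_def by blast
  qed (use assms A in \<open>auto simp: memory_for_def\<close>)
  also have "\<dots> = ?A * ((\<Sum>i\<in>set (table_ids xs). real (?k i))
      + (\<Sum>i\<in>set (table_ids xs). real (?k i * entry_bits \<sigma> r i)))"
    by (simp only: sum.distrib sum_distrib_left distrib_left mult_1_right of_nat_mult)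
  also have "\<dots> \<le> ?A * (G + G * (log 2 (real \<sigma>) + 1 + real r))"
    using A real_sum_num_items real_sum_num_items_entry_bits by (intro add_mono mult_left_mono)
  also have "\<dots> = ?A * (G * (log 2 (real \<sigma>) + 2 + real r))"
    by (simp add: algebra_simps)
  finally show ?thesis .
qed

text \<open>During compaction plain and packed tables coexist, so the two bounds are added.\<close>

lemma memory_bits_le:
  assumes "memory_for \<alpha> \<delta> w (set (table_ids xs)) (num_items xs) M"
  shows "real (memory_bits \<sigma> r w M)
    \<le> (1 / \<alpha> + 1) * (G * (log 2 (real \<sigma>) + 2 + real r))
      + G * (log 2 (real \<sigma>) + packed_const \<alpha> \<kappa> r)"
  using tables_sum_le[OF assms] packed_sum_le[OF assms] by (simp add: memory_bits_def)

lemma memory_bits_compacted_le: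
  "real (memory_bits \<sigma> r w (run \<delta> w (build \<alpha> h sg xs @ bit_compaction xs)))
    \<le> G * (log 2 (real \<sigma>) + packed_const \<alpha> \<kappa> r)"
  using packed_sum_le[OF throughout_last[OF throughout_build(2)]] throughout_build(3)[of \<delta> w \<alpha> h sg xs]
  by (simp add: memory_bits_def run_def)

lemma memory_bits_linear:
  assumes "2 \<le> \<sigma>" "memory_for \<alpha> \<delta> w (set (table_ids xs)) (num_items xs) M"
  shows "real (memory_bits \<sigma> r w M)
    \<le> ((1 / \<alpha> + 1) * (3 + real r) + 1 + packed_const \<alpha> \<kappa> r) * (G * log 2 (real \<sigma>))"
proof -
  let ?L = "log 2 (real \<sigma>)" and ?D = "packed_const \<alpha> \<kappa> r"
  have D: "0 \<le> ?D" unfolding packed_const_def using \<alpha> \<kappa> rank_const_nonneg[of \<alpha> \<kappa>] by simp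
  have L: "1 \<le> ?L" using assms(1) by (simp add: le_log_iff)
  have G: "0 \<le> G" by (simp add: G_def)
  \<comment> \<open>As \<open>?L\<close> is at least 1, an additive constant becomes a factor. The
    instances are \<open>2 + real r\<close> for plain tables and \<open>?D\<close> for packed
    ones.\<close>
  have scale: "G * (?L + X) \<le> (1 + X) * (G * ?L)" if "0 \<le> X" for X
  proof -
    have "?L + X \<le> (1 + X) * ?L" using mult_left_mono[OF L that] by (simp add: algebra_simps)
    from mult_left_mono[OF this G] show ?thesis by (simp add: ac_simps)
  qed
  have "real (memory_bits \<sigma> r w M) \<le> (1 / \<alpha> + 1) * (G * (?L + (2 + real r))) + G * (?L + ?D)"
    using memory_bits_le[OF assms(2)] by (simp add: add.assoc)
  also have "\<dots> \<le> (1 / \<alpha> + 1) * ((1 + (2 + real r)) * (G * ?L)) + (1 + ?D) * (G * ?L)"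
    using \<alpha> D by (intro add_mono mult_left_mono scale) auto
  finally show ?thesis by (simp add: algebra_simps)
qed

lemma peak_bits_le:
  assumes "2 \<le> \<sigma>" and "real (b * w) \<le> W"
    and "throughout (memory_for \<alpha> \<delta> w (set (table_ids xs)) (num_items xs)) \<delta> w
      \<lparr>tables = Map.empty, packed = Map.empty\<rparr> P"
  shows "real (peak_bits \<sigma> r \<delta> w b xs P)
    \<le> W + ((1 / \<alpha> + 1) * (3 + real r) + 3 + packed_const \<alpha> \<kappa> r) * (G * log 2 (real \<sigma>))"
proof -
  let ?L = "log 2 (real \<sigma>)" and ?m = "\<lambda>k. memory_bits \<sigma> r w (run \<delta> w (take k P))"
  have L: "1 \<le> ?L" using assms(1) by (simp add: le_log_iff)
  \<comment> \<open>The maximum is attained at some prefix, where the invariant applies.\<close>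
  have "Max (?m ` {..length P}) \<in> ?m ` {..length P}" by (intro Max_in) auto
  then obtain k where k: "Max (?m ` {..length P}) = ?m k" by blast
  have m: "real (?m k) \<le> ((1 / \<alpha> + 1) * (3 + real r) + 1 + packed_const \<alpha> \<kappa> r) * (G * ?L)"
    using assms(3) unfolding throughout_def run_def by (intro memory_bits_linear assms(1)) blast
  \<comment> \<open>The input strings thus cost at most twice \<open>G * ?L\<close>, which raises
    the constant 1 of \<open>memory_bits_linear\<close> to 3.\<close>
  have "real (char_bits \<sigma>) \<le> ?L + ?L"
    using char_bits_le[of \<sigma>] L assms(1) by linarith
  then have "real (total_length xs * char_bits \<sigma>) \<le> G * (?L + ?L)"
    unfolding of_nat_mult by (intro mult_mono) (auto simp: G_def)
  then show ?thesis
    using m assms(2) unfolding peak_bits_def k by (simp add: algebra_simps)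
qed

end

text \<open>\<open>\<kappa>\<close> is the constant hidden in w = Omega(log n), and \<open>K\<close>
  the one for working storage. Words of length one count in n but not in N, hence bounds in N alone
  assume \<open>real n \<le> c * real N\<close>; with \<open>2 \<le> \<sigma>\<close> the factor log
  \<sigma> is at least 1 and can absorb the constant bits per slot.\<close>

theorem theorem3:
  fixes \<alpha> \<kappa> c K :: real and r \<delta> b :: nat
  assumes "0 < \<alpha>" and "\<alpha> < 1" and "1 \<le> \<delta>" and "0 < \<kappa>"
  shows "\<exists>C::real. \<forall>(\<sigma>::nat) (xs::nat list list) (w::nat)
           (h::nat option list \<Rightarrow> nat) (sg::nat \<Rightarrow> nat) (n::nat) (N::nat).
      is_dictionary \<sigma> xs \<and> n = total_length xs \<and> N = num_pairs xs \<and>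
      0 < w \<and> \<kappa> * log 2 (real n) \<le> real w \<and> (\<forall>a. sg a < 2 ^ r) \<longrightarrow>
      (2 \<le> \<sigma> \<and> real n \<le> c * real N \<longrightarrow>
         real (memory_bits \<sigma> r w (run \<delta> w (build \<alpha> h sg xs))) \<le> C * (real N * log 2 (real \<sigma>)) \<and>
         (real (b * w) \<le> K * (real N * log 2 (real \<sigma>)) \<longrightarrow>
           (\<forall>P \<in> {build \<alpha> h sg xs, build \<alpha> h sg xs @ bit_compaction xs}.
              real (peak_bits \<sigma> r \<delta> w b xs P) \<le> C * (real N * log 2 (real \<sigma>))))) \<and>
      real (memory_bits \<sigma> r w (run \<delta> w (build \<alpha> h sg xs @ bit_compaction xs)))
        \<le> (real N + 2 * real n) * (log 2 (real \<sigma>) + C)"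
proof -
  define A where "A = 1 / \<alpha> + 1"
  define D where "D = packed_const \<alpha> \<kappa> r"
  define X where "X = A * (3 + real r) + 3 + D"
  \<comment> \<open>\<open>\<bar>K\<bar>\<close> pays for working storage, \<open>X\<close> is the
    constant of \<open>peak_bits_le\<close>, and \<open>1 + 2 * \<bar>c\<bar>\<close> converts N +
    2n into N. Absolute values are taken because \<open>c\<close> and \<open>K\<close> are arbitrary
    reals.\<close>
  define C where "C = \<bar>K\<bar> + (1 + 2 * \<bar>c\<bar>) * X"
  have A: "0 \<le> A" using assms by (simp add: A_def)
  have D: "0 \<le> D" unfolding D_def packed_const_def using assms rank_const_nonneg[of \<alpha> \<kappa>] by simp
  have X: "D \<le> X" "0 \<le> X" using A D by (simp_all add: X_def)
  have DC: "D \<le> C"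
  proof -
    have "0 \<le> \<bar>K\<bar> + 2 * \<bar>c\<bar> * X" using X by simp
    then show ?thesis using X unfolding C_def distrib_right by linarith
  qed
  show ?thesis
  proof (intro exI[of _ C] allI impI, elim conjE, intro conjI impI ballI)
    fix \<sigma> xs w h sg n N
    assume dict: "is_dictionary \<sigma> xs" and n: "n = total_length xs" and N: "N = num_pairs xs"
      and w: "0 < w" and word: "\<kappa> * log 2 (real n) \<le> real w"
    note ctx = assms(1,4,3) w dict word[unfolded n]
    let ?L = "log 2 (real \<sigma>)"
    define G where "G = real N + 2 * real n"
    have G0: "0 \<le> G" by (simp add: G_def)
    have "real (memory_bits \<sigma> r w (run \<delta> w (build \<alpha> h sg xs @ bit_compaction xs))) \<le> G * (?L + D)"
      using memory_bits_compacted_le[OF ctx] by (simp add: G_def n N D_def)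
    also have "\<dots> \<le> G * (?L + C)" using DC G0 by (intro mult_left_mono) auto
    finally show "real (memory_bits \<sigma> r w (run \<delta> w (build \<alpha> h sg xs @ bit_compaction xs)))
        \<le> (real N + 2 * real n) * (?L + C)" by (simp add: G_def)
    assume "2 \<le> \<sigma> \<and> real n \<le> c * real N"
    then have \<sigma>: "2 \<le> \<sigma>" and nN: "real n \<le> c * real N" by auto
    have L: "0 \<le> ?L" using \<sigma> by simp
    have "c * real N \<le> \<bar>c\<bar> * real N" by (intro mult_right_mono) auto
    then have "G \<le> (1 + 2 * \<bar>c\<bar>) * real N" using nN by (simp add: G_def algebra_simps)
    then have "G * ?L \<le> (1 + 2 * \<bar>c\<bar>) * real N * ?L" using L by (rule mult_right_mono)
    then have XG: "X * (G * ?L) \<le> X * ((1 + 2 * \<bar>c\<bar>) * real N * ?L)"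
      using X by (intro mult_left_mono)
    have KN: "K * (real N * ?L) \<le> \<bar>K\<bar> * (real N * ?L)" "0 \<le> \<bar>K\<bar> * (real N * ?L)"
      using L by (auto intro: mult_right_mono)
    have bound: "K * (real N * ?L) + X * (G * ?L) \<le> C * (real N * ?L)"
        "X * (G * ?L) \<le> C * (real N * ?L)"
      using XG KN by (simp_all add: C_def algebra_simps)
    \<comment> \<open>Without the input strings the constant is smaller by 2.\<close>
    have X2: "X - 2 = (1 / \<alpha> + 1) * (3 + real r) + 1 + packed_const \<alpha> \<kappa> r"
      by (simp add: X_def A_def D_def)
    have "real (memory_bits \<sigma> r w (run \<delta> w (build \<alpha> h sg xs))) \<le> (X - 2) * (G * ?L)"
      unfolding X2 run_def G_def n N
      by (rule memory_bits_linear[OF ctx \<sigma> throughout_last[OF throughout_build(1)]])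
    also have "\<dots> \<le> X * (G * ?L)" using G0 L by (intro mult_right_mono) auto
    finally show "real (memory_bits \<sigma> r w (run \<delta> w (build \<alpha> h sg xs))) \<le> C * (real N * ?L)"
      using bound by linarith
    fix P
    assume b: "real (b * w) \<le> K * (real N * ?L)"
      and P: "P \<in> {build \<alpha> h sg xs, build \<alpha> h sg xs @ bit_compaction xs}"
    have "throughout (memory_for \<alpha> \<delta> w (set (table_ids xs)) (num_items xs)) \<delta> w
        \<lparr>tables = Map.empty, packed = Map.empty\<rparr> P"
      using P throughout_build by auto
    from peak_bits_le[OF ctx \<sigma> b this, of r] bound(1)
    show "real (peak_bits \<sigma> r \<delta> w b xs P) \<le> C * (real N * ?L)"
      by (simp add: X_def A_def D_def G_def n N)
  qed
qed

end
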